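(* Let $\mathcal{C}$ be a small category where every map factors as a strong epimorphism followed by a monomorphism. For any $n \in \mathbb{N}$ and any object $X$ in $\widehat{\mathcal{C}}$, if $\dim X \leq n$ then $\mathrm{IBD}_n$ holds in $\mathrm{D}X$.
   Context: $\mathbb{N}$ includes $0$. For a small category $\mathcal{C}$, $\widehat{\mathcal{C}}$ denotes the topos of presheaves on $\mathcal{C}$. For $X$ in $\widehat{\mathcal{C}}$, $\mathcal{C}/X$ denotes the category of elements of $X$: objects are pairs $(x,C)$ with $x \in XC$, and maps $(x,C)\to(y,D)$ are maps $f:C\to D$ in $\mathcal{C}$ with $y\cdot f = x$. A map is a strong epimorphism if it is left orthogonal to every monomorphism. An object of a category is minimal if every map with that object as domain is monic; $\mathcal{A}^{\ast}$ denotes the full subcategory of minimal objects of $\mathcal{A}$. $\mathrm{D}X := \widehat{(\mathcal{C}/X)^{\ast}}$. Height: for $n\in\mathbb{N}$, an object $C$ of $\mathcal{C}$ has height below $n$, written $\mathfrak{h} C \leq n$, if every sequence $\cdot \to \cdot \to \cdots \to \cdot \to C$ of $n+1$ composable monomorphisms in $\mathcal{C}$ ending at $C$ contains an isomorphism. Let $\mathcal{C}_n \to \mathcal{C}$ be the full subcategory of objects of height below $n$. The inclusion induces an essential subtopos $n : \widehat{\mathcal{C}_n} \to \widehat{\mathcal{C}}$ with inverse image $n^*$ (restriction) and $n_! \dashv n^*$. The $n$-skeleton $\mathrm{Sk}_n X \to X$ is the image of the counit $n_!(n^*X)\to X$; explicitly, $(\mathrm{Sk}_n X)D$ consists of those $x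 \in XD$ such that there are a map $f : D \to E$ in $\mathcal{C}$ that factors through an object of $\mathcal{C}_n$ and a $y \in XE$ with $x = y \cdot f$. $\dim X \leq n$ means that $\mathrm{Sk}_n X \to X$ is an isomorphism. In the internal language of a topos with subobject classifier $\Omega$, define the closed formulas $\mathrm{IBD}_{-\infty} := \bot$, $\mathrm{IBD}_0 := (\forall x:\Omega)(x \vee (x\Rightarrow \mathrm{IBD}_{-\infty}))$, and $\mathrm{IBD}_{n+1} := (\forall x:\Omega)(x \vee (x \Rightarrow \mathrm{IBD}_n))$ for $n\in\mathbb{N}$. Each is interpreted as a subterminal object; $\mathrm{IBD}_n$ holds in the topos if this subterminal is the terminal object. *)

theory Defs
  imports Main
begin

section \<open>Small categories\<close>

record ('o, 'a) cat =
  Ob  :: "'o set"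
  Ar  :: "'a set"
  Dom :: "'a \<Rightarrow> 'o"
  Cod :: "'a \<Rightarrow> 'o"
  idt :: "'o \<Rightarrow> 'a"
  cmp :: "'a \<Rightarrow> 'a \<Rightarrow> 'a"

text \<open>\<^term>\<open>cmp C g f\<close> is "g after f"; it is only meaningful if \<^term>\<open>Dom C g = Cod C f\<close>.\<close>

definition category :: "('o, 'a) cat \<Rightarrow> bool" where
  "category C \<longleftrightarrow>
     (\<forall>f\<in>Ar C. Dom C f \<in> Ob C \<and> Cod C f \<in> Ob C) \<and>
     (\<forall>c\<in>Ob C. idt C c \<in> Ar C \<and> Dom C (idt C c) = c \<and> Cod C (idt C c) = c) \<and>
     (\<forall>f\<in>Ar C. \<forall>g\<in>Ar C. Dom C g = Cod C f \<longrightarrow>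
        cmp C g f \<in> Ar C \<and> Dom C (cmp C g f) = Dom C f \<and> Cod C (cmp C g f) = Cod C g) \<and>
     (\<forall>f\<in>Ar C. cmp C f (idt C (Dom C f)) = f \<and> cmp C (idt C (Cod C f)) f = f) \<and>
     (\<forall>f\<in>Ar C. \<forall>g\<in>Ar C. \<forall>h\<in>Ar C. Dom C g = Cod C f \<longrightarrow> Dom C h = Cod C g \<longrightarrow>
        cmp C (cmp C h g) f = cmp C h (cmp C g f))"

definition hom :: "('o, 'a) cat \<Rightarrow> 'o \<Rightarrow> 'o \<Rightarrow> 'a set" where
  "hom C c d = {f \<in> Ar C. Dom C f = c \<and> Cod C f = d}"

definition monic :: "('o, 'a) cat \<Rightarrow> 'a \<Rightarrow> bool" where
  "monic C m \<longleftrightarrow> m \<in> Ar C \<and>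
     (\<forall>k\<in>Ob C. \<forall>g\<in>hom C k (Dom C m). \<forall>h\<in>hom C k (Dom C m). cmp C m g = cmp C m h \<longrightarrow> g = h)"

definition iso :: "('o, 'a) cat \<Rightarrow> 'a \<Rightarrow> bool" where
  "iso C f \<longleftrightarrow> f \<in> Ar C \<and>
     (\<exists>g\<in>hom C (Cod C f) (Dom C f). cmp C g f = idt C (Dom C f) \<and> cmp C f g = idt C (Cod C f))"

definition left_orthogonal :: "('o, 'a) cat \<Rightarrow> 'a \<Rightarrow> 'a \<Rightarrow> bool" where
  "left_orthogonal C e m \<longleftrightarrow>
     (\<forall>u\<in>hom C (Dom C e) (Dom C m). \<forall>v\<in>hom C (Cod C e) (Cod C m).
        cmp C v e = cmp C m u \<longrightarrow>
        (\<exists>!d. d \<in> hom C (Cod C e) (Dom C m) \<and> cmp C d e = u \<and> cmp C m d = v))"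

definition strong_epi :: "('o, 'a) cat \<Rightarrow> 'a \<Rightarrow> bool" where
  "strong_epi C e \<longleftrightarrow> e \<in> Ar C \<and> (\<forall>m. monic C m \<longrightarrow> left_orthogonal C e m)"

definition has_strong_epi_mono_factorizations :: "('o, 'a) cat \<Rightarrow> bool" where
  "has_strong_epi_mono_factorizations C \<longleftrightarrow>
     (\<forall>f\<in>Ar C. \<exists>e m. strong_epi C e \<and> monic C m \<and> Dom C m = Cod C e \<and> cmp C m e = f)"

definition full_subcat :: "('o, 'a) cat \<Rightarrow> 'o set \<Rightarrow> ('o, 'a) cat" where
  "full_subcat C S = C\<lparr>Ob := Ob C \<inter> S, Ar := {f \<in> Ar C. Dom C f \<in> S \<and> Cod C f \<in> S}\<rparr>"

definition minimal_obj :: "('o, 'a) cat \<Rightarrow> 'o \<Rightarrow> bool" where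
  "minimal_obj C c \<longleftrightarrow> c \<in> Ob C \<and> (\<forall>f\<in>Ar C. Dom C f = c \<longrightarrow> monic C f)"

definition minimal_subcat :: "('o, 'a) cat \<Rightarrow> ('o, 'a) cat" where
  "minimal_subcat C = full_subcat C {c. minimal_obj C c}"

section \<open>Presheaves\<close>

text \<open>\<^term>\<open>act X x f\<close> is the restriction of x along f. The target of f is determined by f, so
  the sets \<^term>\<open>El X c\<close> need not be disjoint for different c.\<close>

record ('o, 'a, 'x) presheaf =
  El  :: "'o \<Rightarrow> 'x set"
  act :: "'x \<Rightarrow> 'a \<Rightarrow> 'x"

definition is_presheaf :: "('o, 'a) cat \<Rightarrow> ('o, 'a, 'x) presheaf \<Rightarrow> bool" where
  "is_presheaf C X \<longleftrightarrow>
     (\<forall>f\<in>Ar C. \<forall>x\<in>El X (Cod C f). act X x f \<in> El X (Dom C f)) \<and>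
     (\<forall>c\<in>Ob C. \<forall>x\<in>El X c. act X x (idt C c) = x) \<and>
     (\<forall>f\<in>Ar C. \<forall>g\<in>Ar C. Dom C g = Cod C f \<longrightarrow>
        (\<forall>x\<in>El X (Cod C g). act X x (cmp C g f) = act X (act X x g) f))"

definition presheaf_map ::
  "('o, 'a) cat \<Rightarrow> ('o, 'a, 'x) presheaf \<Rightarrow> ('o, 'a, 'y) presheaf \<Rightarrow> ('o \<Rightarrow> 'x \<Rightarrow> 'y) \<Rightarrow> bool" where
  "presheaf_map C X Y \<eta> \<longleftrightarrow>
     (\<forall>c\<in>Ob C. \<forall>x\<in>El X c. \<eta> c x \<in> El Y c) \<and>
     (\<forall>f\<in>Ar C. \<forall>x\<in>El X (Cod C f). \<eta> (Dom C f) (act X x f) = act Y (\<eta> (Cod C f) x) f)"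

definition presheaf_iso ::
  "('o, 'a) cat \<Rightarrow> ('o, 'a, 'x) presheaf \<Rightarrow> ('o, 'a, 'y) presheaf \<Rightarrow> ('o \<Rightarrow> 'x \<Rightarrow> 'y) \<Rightarrow> bool" where
  "presheaf_iso C X Y \<eta> \<longleftrightarrow> presheaf_map C X Y \<eta> \<and>
     (\<exists>\<theta>. presheaf_map C Y X \<theta> \<and>
        (\<forall>c\<in>Ob C. (\<forall>x\<in>El X c. \<theta> c (\<eta> c x) = x) \<and> (\<forall>y\<in>El Y c. \<eta> c (\<theta> c y) = y)))"

text \<open>Subobjects are represented by subsets of the presheaf that are stable under restriction.\<close>

definition subpresheaf ::
  "('o, 'a) cat \<Rightarrow> ('o, 'a, 'x) presheaf \<Rightarrow> ('o \<Rightarrow> 'x set) \<Rightarrow> bool" where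
  "subpresheaf C P A \<longleftrightarrow>
     (\<forall>c\<in>Ob C. A c \<subseteq> El P c) \<and>
     (\<forall>f\<in>Ar C. \<forall>x\<in>A (Cod C f). act P x f \<in> A (Dom C f))"

definition elements ::
  "('o, 'a) cat \<Rightarrow> ('o, 'a, 'x) presheaf \<Rightarrow> ('x \<times> 'o, ('x \<times> 'o) \<times> 'a \<times> ('x \<times> 'o)) cat" where
  "elements C X =
     \<lparr> Ob = {(x, c). c \<in> Ob C \<and> x \<in> El X c},
       Ar = {((x, c), f, (y, d)) | x c f y d.
               f \<in> hom C c d \<and> x \<in> El X c \<and> y \<in> El X d \<and> act X y f = x},
       Dom = (\<lambda>(p, f, q). p),
       Cod = (\<lambda>(p, f, q). q),
       idt = (\<lambda>(x, c). ((x, c), idt C c, (x, c))),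
       cmp = (\<lambda>(q', g, r) (p, f, q). (p, cmp C g f, r)) \<rparr>"

lemma category_elements:
  assumes "category C" "is_presheaf C X"
  shows "category (elements C X)"
proof -
  note C = assms(1)[unfolded category_def] and X = assms(2)[unfolded is_presheaf_def]
  let ?E = "elements C X"
  have Ar: "p \<in> Ar ?E \<longleftrightarrow> (\<exists>f y. p = ((act X y f, Dom C f), f, (y, Cod C f)) \<and> f \<in> Ar C \<and> y \<in> El X (Cod C f))" for p
    using X unfolding elements_def hom_def by auto
  have Ob: "p \<in> Ob ?E \<longleftrightarrow> snd p \<in> Ob C \<and> fst p \<in> El X (snd p)" for p
    unfolding elements_def by auto
  have [simp]: "Dom ?E (p, f, q) = p" "Cod ?E (p, f, q) = q" "idt ?E (x, c) = ((x, c), idt C c, (x, c))"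
    "cmp ?E (q', g, r) (p, f, q) = (p, cmp C g f, r)" for p q q' r f g x c
    unfolding elements_def by auto
  show ?thesis
    unfolding category_def
  proof (intro conjI ballI impI; (elim conjE)?)
    fix p assume "p \<in> Ar ?E"
    then show "Dom ?E p \<in> Ob ?E" "Cod ?E p \<in> Ob ?E"
      "cmp ?E p (idt ?E (Dom ?E p)) = p" "cmp ?E (idt ?E (Cod ?E p)) p = p"
      using C X unfolding Ar Ob by auto
  next
    fix p assume "p \<in> Ob ?E"
    then show "idt ?E p \<in> Ar ?E" "Dom ?E (idt ?E p) = p" "Cod ?E (idt ?E p) = p"
      using C X unfolding Ar Ob by (cases p; auto)+
  next
    fix p q assume p: "p \<in> Ar ?E" and q: "q \<in> Ar ?E" and e: "Dom ?E q = Cod ?E p"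
    obtain f x g y where *: "p = ((act X x f, Dom C f), f, (x, Cod C f))" "f \<in> Ar C" "x \<in> El X (Cod C f)"
      "q = ((act X y g, Dom C g), g, (y, Cod C g))" "g \<in> Ar C" "y \<in> El X (Cod C g)"
      using p q unfolding Ar by blast
    have "act X y g = x" "Dom C g = Cod C f" using e * by auto
    then show "cmp ?E q p \<in> Ar ?E" "Dom ?E (cmp ?E q p) = Dom ?E p" "Cod ?E (cmp ?E q p) = Cod ?E q"
      using * C X unfolding Ar by auto
  next
    fix p q r assume p: "p \<in> Ar ?E" and q: "q \<in> Ar ?E" and r: "r \<in> Ar ?E"
      and e: "Dom ?E q = Cod ?E p" "Dom ?E r = Cod ?E q"
    obtain f x g y h z where *: "p = ((act X x f, Dom C f), f, (x, Cod C f))" "f \<in> Ar C"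
      "q = ((act X y g, Dom C g), g, (y, Cod C g))" "g \<in> Ar C"
      "r = ((act X z h, Dom C h), h, (z, Cod C h))" "h \<in> Ar C"
      using p q r unfolding Ar by blast
    then have "Dom C g = Cod C f" "Dom C h = Cod C g" using e by auto
    then show "cmp ?E (cmp ?E r q) p = cmp ?E r (cmp ?E q p)"
      using * C by auto
  qed
qed

lemma category_full_subcat:
  assumes "category C"
  shows "category (full_subcat C S)"
  using assms unfolding category_def full_subcat_def by auto

section \<open>Height, skeleta and dimension\<close>

text \<open>A list fs of length n + 1 is the sequence
  \<open>\<cdot> \<rightarrow> \<cdot> \<rightarrow> \<dots> \<rightarrow> c\<close> in the order of composition, with \<^term>\<open>last fs\<close> ending at c.\<close>

definition height_le :: "('o, 'a) cat \<Rightarrow> 'o \<Rightarrow> nat \<Rightarrow> bool" where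
  "height_le C c n \<longleftrightarrow>
     (\<forall>fs. length fs = n + 1 \<and> (\<forall>f\<in>set fs. monic C f) \<and>
           (\<forall>i<n. Cod C (fs ! i) = Dom C (fs ! Suc i)) \<and> Cod C (last fs) = c
        \<longrightarrow> (\<exists>f\<in>set fs. iso C f))"

definition height_subcat :: "('o, 'a) cat \<Rightarrow> nat \<Rightarrow> ('o, 'a) cat" where
  "height_subcat C n = full_subcat C {c. height_le C c n}"

text \<open>The skeleton is the image of the counit \<open>n\<^sub>! n\<^sup>* X \<rightarrow> X\<close>, in its explicit description:
  restrictions of elements of X along maps that factor through an object of
  \<^term>\<open>height_subcat C n\<close>.\<close>

definition skeleton ::
  "('o, 'a) cat \<Rightarrow> nat \<Rightarrow> ('o, 'a, 'x) presheaf \<Rightarrow> ('o, 'a, 'x) presheaf" where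
  "skeleton C n X =
     \<lparr> El = (\<lambda>d. {x \<in> El X d. \<exists>e\<in>Ob C. \<exists>f\<in>hom C d e. \<exists>y\<in>El X e.
                   (\<exists>m\<in>Ob (height_subcat C n). \<exists>g\<in>hom C d m. \<exists>h\<in>hom C m e. f = cmp C h g) \<and>
                   x = act X y f}),
       act = act X \<rparr>"

lemma is_presheaf_skeleton:
  assumes C: "category C" and X: "is_presheaf C X"
  shows "is_presheaf C (skeleton C n X)"
proof -
  have "act X x k \<in> El (skeleton C n X) (Dom C k)"
    if k: "k \<in> Ar C" and x: "x \<in> El (skeleton C n X) (Cod C k)" for k x
  proof -
    from x obtain e f y m g h where *: "e \<in> Ob C" "f \<in> hom C (Cod C k) e" "y \<in> El X e"
        "m \<in> Ob (height_subcat C n)" "g \<in> hom C (Cod C k) m" "h \<in> hom C m e" "f = cmp C h g"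
        "x = act X y f" "x \<in> El X (Cod C k)"
      unfolding skeleton_def by auto
    have "cmp C f k \<in> hom C (Dom C k) e" "cmp C g k \<in> hom C (Dom C k) m"
         "cmp C f k = cmp C h (cmp C g k)"
      using * k C unfolding category_def hom_def by auto
    moreover have "act X x k = act X y (cmp C f k)" "act X x k \<in> El X (Dom C k)"
      using * k X unfolding is_presheaf_def hom_def by auto
    ultimately have "\<exists>e\<in>Ob C. \<exists>f\<in>hom C (Dom C k) e. \<exists>y\<in>El X e.
        (\<exists>m\<in>Ob (height_subcat C n). \<exists>g\<in>hom C (Dom C k) m. \<exists>h\<in>hom C m e. f = cmp C h g) \<and>
        act X x k = act X y f"
      using * by blast
    then show ?thesis
      using \<open>act X x k \<in> El X (Dom C k)\<close> unfolding skeleton_def by simp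
  qed
  then show ?thesis
    using X unfolding is_presheaf_def by (simp add: skeleton_def)
qed

definition dim_le :: "('o, 'a) cat \<Rightarrow> ('o, 'a, 'x) presheaf \<Rightarrow> nat \<Rightarrow> bool" where
  "dim_le C X n \<longleftrightarrow> presheaf_iso C (skeleton C n X) X (\<lambda>c x. x)"

section \<open>The subobject classifier of a presheaf topos\<close>

definition sieve :: "('o, 'a) cat \<Rightarrow> 'o \<Rightarrow> 'a set \<Rightarrow> bool" where
  "sieve C c S \<longleftrightarrow>
     (\<forall>f\<in>S. f \<in> Ar C \<and> Cod C f = c) \<and>
     (\<forall>f\<in>S. \<forall>g\<in>Ar C. Cod C g = Dom C f \<longrightarrow> cmp C f g \<in> S)"

definition max_sieve :: "('o, 'a) cat \<Rightarrow> 'o \<Rightarrow> 'a set" where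
  "max_sieve C c = {f \<in> Ar C. Cod C f = c}"

definition Omega :: "('o, 'a) cat \<Rightarrow> ('o, 'a, 'a set) presheaf" where
  "Omega C =
     \<lparr> El = (\<lambda>c. {S. sieve C c S}),
       act = (\<lambda>S f. {g \<in> Ar C. Cod C g = Dom C f \<and> cmp C f g \<in> S}) \<rparr>"

lemma is_presheaf_Omega:
  assumes "category C"
  shows "is_presheaf C (Omega C)"
  unfolding is_presheaf_def
proof (intro conjI ballI impI)
  note C = assms[unfolded category_def]
  fix f S assume f: "f \<in> Ar C" and S: "S \<in> El (Omega C) (Cod C f)"
  have "cmp C g h \<in> Ar C \<and> Cod C (cmp C g h) = Dom C f \<and> cmp C f (cmp C g h) \<in> S"
    if g: "g \<in> Ar C" "Cod C g = Dom C f" "cmp C f g \<in> S" and h: "h \<in> Ar C" "Cod C h = Dom C g" for g h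
  proof -
    have "cmp C (cmp C f g) h = cmp C f (cmp C g h)" "Dom C (cmp C f g) = Dom C g"
      using C f g h by simp_all
    then have "cmp C f (cmp C g h) \<in> S"
      using S g h unfolding Omega_def sieve_def by (simp, metis)
    then show ?thesis using C g h by simp
  qed
  then show "act (Omega C) S f \<in> El (Omega C) (Dom C f)"
    unfolding Omega_def sieve_def by auto
next
  fix c S assume "c \<in> Ob C" "S \<in> El (Omega C) c"
  then show "act (Omega C) S (idt C c) = S"
    using assms unfolding category_def Omega_def sieve_def by (auto; metis)
next
  fix f g S assume "f \<in> Ar C" "g \<in> Ar C" "Dom C g = Cod C f" "S \<in> El (Omega C) (Cod C g)"
  then show "act (Omega C) S (cmp C g f) = act (Omega C) (act (Omega C) S g) f"
    using assms unfolding category_def Omega_def by auto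
qed

lemma Omega_classifies:
  assumes C: "category C" and P: "is_presheaf C P" and A: "subpresheaf C P A"
  shows "\<exists>\<chi>. presheaf_map C P (Omega C) \<chi> \<and>
             (\<forall>c\<in>Ob C. A c = {x \<in> El P c. \<chi> c x = max_sieve C c})"
    and "\<lbrakk>presheaf_map C P (Omega C) \<chi>; \<forall>c\<in>Ob C. A c = {x \<in> El P c. \<chi> c x = max_sieve C c};
          presheaf_map C P (Omega C) \<psi>; \<forall>c\<in>Ob C. A c = {x \<in> El P c. \<psi> c x = max_sieve C c};
          c \<in> Ob C; x \<in> El P c\<rbrakk> \<Longrightarrow> \<chi> c x = \<psi> c x"
proof -
  let ?\<chi> = "\<lambda>c x. {f \<in> Ar C. Cod C f = c \<and> act P x f \<in> A (Dom C f)}"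
  have 1: "presheaf_map C P (Omega C) ?\<chi>"
    unfolding presheaf_map_def
  proof (intro conjI ballI)
    fix c x assume c: "c \<in> Ob C" "x \<in> El P c"
    show "?\<chi> c x \<in> El (Omega C) c"
      unfolding Omega_def sieve_def
    proof (simp, intro allI impI ballI)
      fix f g assume f: "f \<in> Ar C \<and> Cod C f = c \<and> act P x f \<in> A (Dom C f)"
        and g: "g \<in> Ar C" "Cod C g = Dom C f"
      have "act P x (cmp C f g) = act P (act P x f) g"
        using f g c P unfolding is_presheaf_def by auto
      moreover have "act P (act P x f) g \<in> A (Dom C g)"
        using f g A unfolding subpresheaf_def by auto
      ultimately show "cmp C f g \<in> Ar C \<and> Cod C (cmp C f g) = c \<and> act P x (cmp C f g) \<in> A (Dom C (cmp C f g))"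
        using f g C unfolding category_def by auto
    qed
  next
    fix f x assume f: "f \<in> Ar C" "x \<in> El P (Cod C f)"
    show "?\<chi> (Dom C f) (act P x f) = act (Omega C) (?\<chi> (Cod C f) x) f"
      using f P C unfolding Omega_def category_def is_presheaf_def by auto
  qed
  have 2: "A c = {x \<in> El P c. ?\<chi> c x = max_sieve C c}" if c: "c \<in> Ob C" for c
  proof
    show "A c \<subseteq> {x \<in> El P c. ?\<chi> c x = max_sieve C c}"
      using c A unfolding subpresheaf_def max_sieve_def by auto
    show "{x \<in> El P c. ?\<chi> c x = max_sieve C c} \<subseteq> A c"
    proof clarify
      fix x assume x: "x \<in> El P c" "?\<chi> c x = max_sieve C c"
      have i: "idt C c \<in> Ar C" "Cod C (idt C c) = c" "Dom C (idt C c) = c"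
        using c C unfolding category_def by auto
      then have "idt C c \<in> ?\<chi> c x" using x(2) unfolding max_sieve_def by blast
      then have "act P x (idt C c) \<in> A c" using i by simp
      then show "x \<in> A c" using x c P unfolding is_presheaf_def by auto
    qed
  qed
  show "\<exists>\<chi>. presheaf_map C P (Omega C) \<chi> \<and>
             (\<forall>c\<in>Ob C. A c = {x \<in> El P c. \<chi> c x = max_sieve C c})"
    using 1 2 by blast
  have key: "\<chi> c x = {f \<in> Ar C. Cod C f = c \<and> act P x f \<in> A (Dom C f)}"
    if m: "presheaf_map C P (Omega C) \<chi>"
      and a: "\<forall>c\<in>Ob C. A c = {x \<in> El P c. \<chi> c x = max_sieve C c}"
      and c: "c \<in> Ob C" "x \<in> El P c" for \<chi> c x
  proof -
    have s: "sieve C c (\<chi> c x)" using m c unfolding presheaf_map_def Omega_def by auto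
    have "f \<in> \<chi> c x \<longleftrightarrow> act P x f \<in> A (Dom C f)" if f: "f \<in> Ar C" "Cod C f = c" for f
    proof -
      let ?d = "Dom C f"
      have d: "?d \<in> Ob C" "act P x f \<in> El P ?d" "idt C ?d \<in> Ar C" "Cod C (idt C ?d) = ?d"
          "cmp C f (idt C ?d) = f"
        using f c C P unfolding category_def is_presheaf_def by auto
      have e: "\<chi> ?d (act P x f) = {g \<in> Ar C. Cod C g = ?d \<and> cmp C f g \<in> \<chi> c x}"
        using m f c unfolding presheaf_map_def Omega_def by auto
      have "act P x f \<in> A ?d \<longleftrightarrow> \<chi> ?d (act P x f) = max_sieve C ?d"
        using a d by auto
      also have "\<dots> \<longleftrightarrow> f \<in> \<chi> c x"
      proof
        assume "\<chi> ?d (act P x f) = max_sieve C ?d"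
        moreover have "idt C ?d \<in> max_sieve C ?d" using d unfolding max_sieve_def by simp
        ultimately have "cmp C f (idt C ?d) \<in> \<chi> c x" unfolding e by auto
        then show "f \<in> \<chi> c x" using d by simp
      next
        assume "f \<in> \<chi> c x"
        then show "\<chi> ?d (act P x f) = max_sieve C ?d"
          using s unfolding e max_sieve_def sieve_def by auto
      qed
      finally show ?thesis by simp
    qed
    then show ?thesis using s unfolding sieve_def by blast
  qed
  show "\<chi> c x = \<psi> c x"
    if "presheaf_map C P (Omega C) \<chi>" "\<forall>c\<in>Ob C. A c = {x \<in> El P c. \<chi> c x = max_sieve C c}"
       "presheaf_map C P (Omega C) \<psi>" "\<forall>c\<in>Ob C. A c = {x \<in> El P c. \<psi> c x = max_sieve C c}"
       "c \<in> Ob C" "x \<in> El P c"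
    using key[OF that(1,2,5,6)] key[OF that(3-6)] by simp
qed

definition Omega_pow :: "('o, 'a) cat \<Rightarrow> nat \<Rightarrow> ('o, 'a, 'a set list) presheaf" where
  "Omega_pow C n =
     \<lparr> El = (\<lambda>c. {\<rho>. length \<rho> = n \<and> (\<forall>S\<in>set \<rho>. S \<in> El (Omega C) c)}),
       act = (\<lambda>\<rho> f. map (\<lambda>S. act (Omega C) S f) \<rho>) \<rparr>"

lemma is_presheaf_Omega_pow:
  assumes "category C"
  shows "is_presheaf C (Omega_pow C n)"
  using is_presheaf_Omega[OF assms] unfolding is_presheaf_def Omega_pow_def
  by (auto intro!: map_idI)

section \<open>Internal logic of a presheaf topos\<close>

text \<open>Heyting implication in the lattice of subobjects of P.\<close>

definition sub_imp :: "('o, 'a) cat \<Rightarrow> ('o, 'a, 'x) presheaf \<Rightarrow>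
    ('o \<Rightarrow> 'x set) \<Rightarrow> ('o \<Rightarrow> 'x set) \<Rightarrow> 'o \<Rightarrow> 'x set" where
  "sub_imp C P A B c = {x \<in> El P c. \<forall>f\<in>Ar C. Cod C f = c \<longrightarrow>
     act P x f \<in> A (Dom C f) \<longrightarrow> act P x f \<in> B (Dom C f)}"

lemma sub_imp_adjoint:
  assumes C: "category C" and P: "is_presheaf C P"
  shows "subpresheaf C P (sub_imp C P A B)"
    and "subpresheaf C P K \<Longrightarrow>
      (\<forall>c\<in>Ob C. K c \<subseteq> sub_imp C P A B c) \<longleftrightarrow> (\<forall>c\<in>Ob C. K c \<inter> A c \<subseteq> B c)"
proof -
  show "subpresheaf C P (sub_imp C P A B)"
    unfolding subpresheaf_def sub_imp_def
  proof (safe)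
    fix f x g
    assume f: "f \<in> Ar C" "x \<in> El P (Cod C f)"
      and h: "\<forall>fa\<in>Ar C. Cod C fa = Cod C f \<longrightarrow> act P x fa \<in> A (Dom C fa) \<longrightarrow> act P x fa \<in> B (Dom C fa)"
    show "act P x f \<in> El P (Dom C f)" using f P unfolding is_presheaf_def by auto
    assume g: "g \<in> Ar C" "Cod C g = Dom C f" "act P (act P x f) g \<in> A (Dom C g)"
    have "act P (act P x f) g = act P x (cmp C f g)"
      using f g P unfolding is_presheaf_def by auto
    moreover have "cmp C f g \<in> Ar C" "Cod C (cmp C f g) = Cod C f" "Dom C (cmp C f g) = Dom C g"
      using f g C unfolding category_def by auto
    ultimately show "act P (act P x f) g \<in> B (Dom C g)" using h g by auto
  qed
  assume K: "subpresheaf C P K"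
  show "(\<forall>c\<in>Ob C. K c \<subseteq> sub_imp C P A B c) \<longleftrightarrow> (\<forall>c\<in>Ob C. K c \<inter> A c \<subseteq> B c)"
  proof (intro iffI ballI subsetI)
    fix c x assume l: "\<forall>c\<in>Ob C. K c \<subseteq> sub_imp C P A B c" and c: "c \<in> Ob C" and x: "x \<in> K c \<inter> A c"
    have i: "idt C c \<in> Ar C" "Cod C (idt C c) = c" "Dom C (idt C c) = c"
      using c C unfolding category_def by auto
    have "x \<in> sub_imp C P A B c" using l c x by blast
    then have "act P x (idt C c) \<in> A c \<longrightarrow> act P x (idt C c) \<in> B c" "x \<in> El P c"
      using i unfolding sub_imp_def by auto
    then show "x \<in> B c" using x c P unfolding is_presheaf_def by auto
  next
    fix c x assume r: "\<forall>c\<in>Ob C. K c \<inter> A c \<subseteq> B c" and c: "c \<in> Ob C" and x: "x \<in> K c"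
    show "x \<in> sub_imp C P A B c"
      using r c x K C unfolding sub_imp_def subpresheaf_def category_def by blast
  qed
qed

text \<open>Universal quantification along the projection \<open>\<Omega>\<^bsup>n+1\<^esup> \<rightarrow> \<Omega>\<^bsup>n\<^esup>\<close> that forgets the first
  component.\<close>

definition sub_forall :: "('o, 'a) cat \<Rightarrow> nat \<Rightarrow> ('o \<Rightarrow> 'a set list set) \<Rightarrow> 'o \<Rightarrow> 'a set list set" where
  "sub_forall C n A c = {\<rho> \<in> El (Omega_pow C n) c. \<forall>f\<in>Ar C. Cod C f = c \<longrightarrow>
     (\<forall>S\<in>El (Omega C) (Dom C f). S # act (Omega_pow C n) \<rho> f \<in> A (Dom C f))}"

lemma sub_forall_adjoint:
  assumes C: "category C"
  shows "subpresheaf C (Omega_pow C n) (sub_forall C n A)"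
    and "subpresheaf C (Omega_pow C n) K \<Longrightarrow>
      (\<forall>c\<in>Ob C. K c \<subseteq> sub_forall C n A c) \<longleftrightarrow>
      (\<forall>c\<in>Ob C. {\<rho> \<in> El (Omega_pow C (Suc n)) c. tl \<rho> \<in> K c} \<subseteq> A c)"
proof -
  let ?P = "Omega_pow C n"
  have P: "is_presheaf C ?P" using is_presheaf_Omega_pow[OF C] .
  show "subpresheaf C ?P (sub_forall C n A)"
    unfolding subpresheaf_def sub_forall_def
  proof (safe)
    fix f x g S
    assume f: "f \<in> Ar C" "x \<in> El ?P (Cod C f)"
      and h: "\<forall>fa\<in>Ar C. Cod C fa = Cod C f \<longrightarrow>
         (\<forall>S\<in>El (Omega C) (Dom C fa). S # act ?P x fa \<in> A (Dom C fa))"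
    show "act ?P x f \<in> El ?P (Dom C f)" using f P unfolding is_presheaf_def by auto
    assume g: "g \<in> Ar C" "Cod C g = Dom C f" "S \<in> El (Omega C) (Dom C g)"
    have "act ?P (act ?P x f) g = act ?P x (cmp C f g)"
      using f g P unfolding is_presheaf_def by auto
    moreover have "cmp C f g \<in> Ar C" "Cod C (cmp C f g) = Cod C f" "Dom C (cmp C f g) = Dom C g"
      using f g C unfolding category_def by auto
    ultimately show "S # act ?P (act ?P x f) g \<in> A (Dom C g)" using h g by auto
  qed
  assume K: "subpresheaf C ?P K"
  show "(\<forall>c\<in>Ob C. K c \<subseteq> sub_forall C n A c) \<longleftrightarrow>
      (\<forall>c\<in>Ob C. {\<rho> \<in> El (Omega_pow C (Suc n)) c. tl \<rho> \<in> K c} \<subseteq> A c)"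
  proof (intro iffI ballI subsetI)
    fix c \<rho> assume l: "\<forall>c\<in>Ob C. K c \<subseteq> sub_forall C n A c" and c: "c \<in> Ob C"
      and r: "\<rho> \<in> {\<rho> \<in> El (Omega_pow C (Suc n)) c. tl \<rho> \<in> K c}"
    obtain S \<tau> where \<rho>: "\<rho> = S # \<tau>" "S \<in> El (Omega C) c" "\<tau> \<in> K c"
      using r unfolding Omega_pow_def by (cases \<rho>) auto
    have i: "idt C c \<in> Ar C" "Cod C (idt C c) = c" "Dom C (idt C c) = c"
      using c C unfolding category_def by auto
    have "\<tau> \<in> sub_forall C n A c" using l c \<rho> by blast
    then have "S # act ?P \<tau> (idt C c) \<in> A c" "\<tau> \<in> El ?P c"
      using i \<rho> unfolding sub_forall_def by auto
    then show "\<rho> \<in> A c" using \<rho>(1) c P unfolding is_presheaf_def by auto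
  next
    fix c \<tau> assume r: "\<forall>c\<in>Ob C. {\<rho> \<in> El (Omega_pow C (Suc n)) c. tl \<rho> \<in> K c} \<subseteq> A c"
      and c: "c \<in> Ob C" and t: "\<tau> \<in> K c"
    have "S # act ?P \<tau> f \<in> A (Dom C f)"
      if f: "f \<in> Ar C" "Cod C f = c" "S \<in> El (Omega C) (Dom C f)" for f S
    proof -
      have d: "Dom C f \<in> Ob C" using f C unfolding category_def by auto
      have k: "act ?P \<tau> f \<in> K (Dom C f)" using f t K unfolding subpresheaf_def by auto
      then have "act ?P \<tau> f \<in> El ?P (Dom C f)" using K d unfolding subpresheaf_def by auto
      then have "S # act ?P \<tau> f \<in> El (Omega_pow C (Suc n)) (Dom C f)"
        using f unfolding Omega_pow_def by auto
      moreover have "tl (S # act ?P \<tau> f) \<in> K (Dom C f)" using k by simp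
      ultimately show ?thesis using r d by blast
    qed
    then show "\<tau> \<in> sub_forall C n A c"
      using c t K unfolding sub_forall_def subpresheaf_def by auto
  qed
qed

text \<open>Formulas whose variables all have type \<open>\<Omega>\<close>, with de Bruijn indices: \<open>All\<close> binds index 0.\<close>

datatype form = Var nat | Bot | Or form form | Imp form form | All form

text \<open>A formula in a context of n variables denotes a subobject of \<open>\<Omega>\<^bsup>n\<^esup>\<close>. A variable denotes
  the pullback of \<open>true : 1 \<rightarrow> \<Omega>\<close> along the corresponding projection.\<close>

primrec interp :: "('o, 'a) cat \<Rightarrow> nat \<Rightarrow> form \<Rightarrow> 'o \<Rightarrow> 'a set list set" where
  "interp C n (Var i) = (\<lambda>c. {\<rho> \<in> El (Omega_pow C n) c. \<rho> ! i = max_sieve C c})"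
| "interp C n Bot = (\<lambda>c. {})"
| "interp C n (Or \<phi> \<psi>) = (\<lambda>c. interp C n \<phi> c \<union> interp C n \<psi> c)"
| "interp C n (Imp \<phi> \<psi>) = sub_imp C (Omega_pow C n) (interp C n \<phi>) (interp C n \<psi>)"
| "interp C n (All \<phi>) = sub_forall C n (interp C (Suc n) \<phi>)"

text \<open>Validity of a closed formula in the topos of presheaves on C: the subterminal object
  that it denotes is all of \<open>\<Omega>\<^bsup>0\<^esup> = 1\<close>.\<close>

definition holds_in_presheaf_topos :: "('o, 'a) cat \<Rightarrow> form \<Rightarrow> bool" where
  "holds_in_presheaf_topos C \<phi> \<longleftrightarrow> (\<forall>c\<in>Ob C. interp C 0 \<phi> c = El (Omega_pow C 0) c)"

text \<open>No index shift is needed below \<open>All\<close>, as the formulas are closed.\<close>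

definition IBD_minus_infinity :: form where
  "IBD_minus_infinity = Bot"

primrec IBD :: "nat \<Rightarrow> form" where
  "IBD 0 = All (Or (Var 0) (Imp (Var 0) IBD_minus_infinity))"
| "IBD (Suc n) = All (Or (Var 0) (Imp (Var 0) (IBD n)))"

end

theory Submission
  imports Defs
begin

text \<open>By Kripke--Joyal forcing, a failure of \<^term>\<open>IBD n\<close> in the presheaves on a category
  yields n + 1 composable maps none of which is an isomorphism. All maps of the category of
  minimal objects are monic. If X has dimension at most n, then every minimal element (x, c) maps to
  some (z, m) with m of height at most n, and this map is monic by minimality. Hence a chain of
  n + 1 maps of minimal elements ending at (x, c) extends to a chain of n + 1 monomorphisms
  ending at m, which contains an isomorphism.\<close>

section \<open>Bounded depth in presheaf toposes\<close>

text \<open>Composing the isomorphism with its inverse puts the identity of \<open>c\<close> into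
  the sieve, and every map into \<open>c\<close> factors through that identity.\<close>

lemma sieve_eq_max_sieve_if_iso_mem:
  assumes C: "category C" and S: "sieve C c S" and f: "f \<in> S" "iso C f"
  shows "S = max_sieve C c"
proof -
  have fc: "f \<in> Ar C" "Cod C f = c" using S f unfolding sieve_def by auto
  obtain g where "g \<in> hom C c (Dom C f)" "cmp C f g = idt C c"
    using f(2) fc unfolding iso_def by auto
  then have i: "idt C c \<in> S" using S f(1) unfolding sieve_def hom_def by force
  have "h \<in> S" if "h \<in> Ar C" "Cod C h = c" for h
  proof -
    have "Dom C (idt C c) = c" "cmp C (idt C c) h = h" using C that unfolding category_def by auto
    then show ?thesis using S i that unfolding sieve_def by metis
  qed
  then show ?thesis using S unfolding sieve_def max_sieve_def by auto
qed

text \<open>One round of Kripke--Joyal unwinding. The quantifier moves along \<open>f\<close> and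
  picks the sieve \<open>S\<close>; failure of the first disjunct means that \<open>S\<close> is not
  maximal, failure of the implication gives \<open>g\<close> in \<open>S\<close> at whose domain
  \<open>\<phi>\<close> fails.\<close>

lemma not_interp_All_Or_ImpE:
  assumes C: "category C" and \<rho>: "\<rho> \<in> El (Omega_pow C m) c"
    and n: "\<rho> \<notin> interp C m (All (Or (Var 0) (Imp (Var 0) \<phi>))) c"
  obtains f S g \<sigma> where "f \<in> Ar C" "Cod C f = c" "sieve C (Dom C f) S" "S \<noteq> max_sieve C (Dom C f)"
    "g \<in> S" "\<sigma> \<in> El (Omega_pow C (Suc m)) (Dom C g)" "\<sigma> \<notin> interp C (Suc m) \<phi> (Dom C g)"
proof -
  let ?P = "Omega_pow C (Suc m)"
  from n \<rho> obtain f S where f: "f \<in> Ar C" "Cod C f = c" and S: "S \<in> El (Omega C) (Dom C f)"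
    and x: "S # act (Omega_pow C m) \<rho> f \<notin> interp C (Suc m) (Or (Var 0) (Imp (Var 0) \<phi>)) (Dom C f)"
      (is "?x \<notin> _")
    by (auto simp: sub_forall_def)
  have "act (Omega_pow C m) \<rho> f \<in> El (Omega_pow C m) (Dom C f)"
    using is_presheaf_Omega_pow[OF C] f \<rho> unfolding is_presheaf_def by blast
  then have xE: "?x \<in> El ?P (Dom C f)" using S by (auto simp: Omega_pow_def)
  from x xE obtain g where g: "g \<in> Ar C" "Cod C g = Dom C f"
    and nm: "S \<noteq> max_sieve C (Dom C f)"
    and v: "act ?P ?x g \<in> interp C (Suc m) (Var 0) (Dom C g)"
    and \<phi>: "act ?P ?x g \<notin> interp C (Suc m) \<phi> (Dom C g)"
    by (auto simp: sub_imp_def)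
  \<comment> \<open>The restriction of \<open>S\<close> along \<open>g\<close> is maximal, so it
    contains the identity, which says exactly that \<open>g\<close> lies in
    \<open>S\<close>.\<close>
  have m: "act (Omega C) S g = max_sieve C (Dom C g)" using v by (simp add: Omega_pow_def)
  have i: "Dom C g \<in> Ob C" "cmp C g (idt C (Dom C g)) = g" using C g unfolding category_def by auto
  then have "idt C (Dom C g) \<in> max_sieve C (Dom C g)"
    using C unfolding max_sieve_def category_def by auto
  then have "g \<in> S" using i(2) unfolding m[symmetric] by (simp add: Omega_def)
  moreover have "act ?P ?x g \<in> El ?P (Dom C g)" using v by simp
  moreover have "sieve C (Dom C f) S" using S by (simp add: Omega_def)
  ultimately show thesis using that f nm \<phi> by blast
qed

definition composable :: "('o, 'a) cat \<Rightarrow> 'a list \<Rightarrow> bool" where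
  "composable C fs \<longleftrightarrow> set fs \<subseteq> Ar C \<and> successively (\<lambda>f g. Cod C f = Dom C g) fs"

text \<open>Each round of unwinding contributes one map from a non-maximal sieve, and such a map is
  not an isomorphism. The context length \<open>m\<close> varies in the induction since every
  quantifier adds a variable. The map \<open>u\<close> connects the end of the chain to
  \<open>c\<close>, so that the next round can prolong the chain.\<close>

lemma not_interp_IBD_obtains_chain:
  assumes C: "category C" and \<rho>: "\<rho> \<in> El (Omega_pow C m) c" and n: "\<rho> \<notin> interp C m (IBD k) c"
  shows "\<exists>fs. length fs = Suc k \<and> composable C fs \<and> (\<forall>f\<in>set fs. \<not> iso C f) \<and>
              (\<exists>u. u \<in> hom C (Cod C (last fs)) c)"
  using \<rho> n
proof (induction k arbitrary: m c \<rho>)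
  case 0
  from 0(2) obtain f S g where *: "f \<in> Ar C" "Cod C f = c" "sieve C (Dom C f) S"
      "S \<noteq> max_sieve C (Dom C f)" "g \<in> S"
    unfolding IBD.simps using not_interp_All_Or_ImpE[OF C 0(1)] by metis
  then have "g \<in> Ar C" "Cod C g = Dom C f" "\<not> iso C g"
    using sieve_eq_max_sieve_if_iso_mem[OF C] unfolding sieve_def by blast+
  then show ?case
    using * by (intro exI[of _ "[g]"]) (auto simp: composable_def hom_def)
next
  case (Suc k)
  from Suc.prems(2) obtain f S g \<sigma> where *: "f \<in> Ar C" "Cod C f = c" "sieve C (Dom C f) S"
      "S \<noteq> max_sieve C (Dom C f)" "g \<in> S" "\<sigma> \<in> El (Omega_pow C (Suc m)) (Dom C g)"
      "\<sigma> \<notin> interp C (Suc m) (IBD k) (Dom C g)"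
    unfolding IBD.simps using not_interp_All_Or_ImpE[OF C Suc.prems(1)] by metis
  obtain fs u where fs: "length fs = Suc k" "composable C fs" "\<forall>f\<in>set fs. \<not> iso C f"
      and u: "u \<in> Ar C" "Dom C u = Cod C (last fs)" "Cod C u = Dom C g"
    using Suc.IH[OF *(6,7)] unfolding hom_def by auto
  \<comment> \<open>Precomposing \<open>g\<close> with \<open>u\<close> attaches it to the end of
    \<open>fs\<close> and stays in the sieve \<open>S\<close>; then \<open>f\<close> serves as the
    new connecting map to \<open>c\<close>.\<close>
  let ?h = "cmp C g u"
  have g: "g \<in> Ar C" "Cod C g = Dom C f" using * unfolding sieve_def by auto
  have h: "?h \<in> Ar C" "Dom C ?h = Cod C (last fs)" "Cod C ?h = Dom C f"
    using C u g unfolding category_def by auto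
  have "?h \<in> S" using *(3,5) u unfolding sieve_def by auto
  then have "\<not> iso C ?h" using sieve_eq_max_sieve_if_iso_mem[OF C *(3)] *(4) by blast
  then show ?case
    using fs h * by (intro exI[of _ "fs @ [?h]"])
      (auto simp: composable_def hom_def successively_append_iff)
qed

proposition IBD_holds_if_chains_contain_iso:
  assumes "category C"
    and "\<And>fs. \<lbrakk>length fs = Suc n; composable C fs\<rbrakk> \<Longrightarrow> \<exists>f\<in>set fs. iso C f"
  shows "holds_in_presheaf_topos C (IBD n)"
  unfolding holds_in_presheaf_topos_def
proof (intro ballI subset_antisym subsetI)
  fix c \<rho> assume "\<rho> \<in> El (Omega_pow C 0) c"
  then show "\<rho> \<in> interp C 0 (IBD n) c"
    using not_interp_IBD_obtains_chain[OF assms(1)] assms(2) by meson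
next
  fix c \<rho> assume "\<rho> \<in> interp C 0 (IBD n) c"
  \<comment> \<open>The case split only exposes the outer \<open>All\<close>, whose interpretation
    lies in the context by definition.\<close>
  then show "\<rho> \<in> El (Omega_pow C 0) c" by (cases n) (auto simp: sub_forall_def)
qed

section \<open>Monomorphisms and isomorphisms\<close>

lemma monic_cmp:
  assumes C: "category C" and f: "monic C f" and g: "monic C g" and fg: "Dom C g = Cod C f"
  shows "monic C (cmp C g f)"
proof -
  have ar: "f \<in> Ar C" "g \<in> Ar C" using f g unfolding monic_def by auto
  have gf: "cmp C g f \<in> Ar C" "Dom C (cmp C g f) = Dom C f"
    using C ar fg unfolding category_def by auto
  have "h = k" if h: "h \<in> hom C c (Dom C f)" and k: "k \<in> hom C c (Dom C f)" and c: "c \<in> Ob C"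
    and e: "cmp C (cmp C g f) h = cmp C (cmp C g f) k" for h k c
  proof -
    have "cmp C g (cmp C f h) = cmp C g (cmp C f k)"
      using e C ar fg h k unfolding category_def hom_def by auto
    moreover have "cmp C f h \<in> hom C c (Dom C g)" "cmp C f k \<in> hom C c (Dom C g)"
      using C ar fg h k unfolding category_def hom_def by auto
    ultimately have "cmp C f h = cmp C f k" using g c unfolding monic_def by blast
    then show ?thesis using f c h k unfolding monic_def by blast
  qed
  then show ?thesis using gf unfolding monic_def by auto
qed

text \<open>If \<open>k\<close> is inverse to the composite of \<open>f\<close> and
  \<open>g\<close>, then \<open>k\<close> after \<open>g\<close> is a left inverse of
  \<open>f\<close>; cancelling the monic \<open>g\<close> shows that it is also a right
  inverse.\<close>

lemma iso_right_if_iso_cmp_monic: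
  assumes C: "category C" and f: "f \<in> Ar C" and g: "monic C g" and fg: "Dom C g = Cod C f"
    and i: "iso C (cmp C g f)"
  shows "iso C f"
proof -
  note cat = C[unfolded category_def]
  have gA: "g \<in> Ar C" using g unfolding monic_def by auto
  obtain k where k: "k \<in> Ar C" "Dom C k = Cod C g" "Cod C k = Dom C f"
      and kgf: "cmp C k (cmp C g f) = idt C (Dom C f)"
      and gfk: "cmp C (cmp C g f) k = idt C (Cod C g)"
    using i cat f gA fg unfolding iso_def hom_def by auto
  let ?l = "cmp C k g"
  have l: "?l \<in> Ar C" "Dom C ?l = Cod C f" "Cod C ?l = Dom C f" using cat k gA fg by auto
  have lf: "cmp C ?l f = idt C (Dom C f)" using cat k gA fg kgf f by auto
  have fl: "cmp C f ?l \<in> hom C (Cod C f) (Cod C f)" using cat l f unfolding hom_def by auto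
  have id: "idt C (Cod C f) \<in> hom C (Cod C f) (Cod C f)" "Cod C f \<in> Ob C"
    using cat f unfolding hom_def by auto
  have "cmp C g (cmp C f ?l) = cmp C (cmp C g f) (cmp C k g)" using cat f gA fg l by auto
  also have "\<dots> = cmp C (cmp C (cmp C g f) k) g" using cat f gA fg k by auto
  also have "\<dots> = cmp C g (idt C (Cod C f))" using cat gA fg gfk by metis
  finally have "cmp C f ?l = idt C (Cod C f)"
    using g id fl fg unfolding monic_def by metis
  then show ?thesis using f l lf unfolding iso_def hom_def by auto
qed

section \<open>Minimal elements\<close>

lemma elements_simps [simp]:
  "Dom (elements C X) (p, f, q) = p" "Cod (elements C X) (p, f, q) = q"
  "idt (elements C X) (x, c) = ((x, c), idt C c, (x, c))"
  "cmp (elements C X) (q', g, r) (p, f, q) = (p, cmp C g f, r)"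
  unfolding elements_def by auto

lemma Ob_elements_iff [simp]: "(x, c) \<in> Ob (elements C X) \<longleftrightarrow> c \<in> Ob C \<and> x \<in> El X c"
  by (simp add: elements_def)

lemma Ar_elements_iff:
  "((x, c), f, (y, d)) \<in> Ar (elements C X) \<longleftrightarrow>
     f \<in> hom C c d \<and> x \<in> El X c \<and> y \<in> El X d \<and> act X y f = x"
  by (auto simp: elements_def)

text \<open>Two maps \<open>g\<close>, \<open>h\<close> into \<open>c\<close> that \<open>f\<close>
  equalizes lift to maps into \<open>(x, c)\<close> with a common domain, because restricting
  \<open>x\<close> along either is restricting \<open>y\<close> along the same composite.\<close>

lemma monic_if_monic_elements:
  assumes C: "category C" and X: "is_presheaf C X"
    and m: "monic (elements C X) ((x, c), f, (y, d))"
  shows "monic C f"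
proof -
  have f: "f \<in> Ar C" "Dom C f = c" "Cod C f = d" and xy: "x \<in> El X c" "y \<in> El X d" "act X y f = x"
    using m unfolding monic_def Ar_elements_iff hom_def by auto
  have "g = h" if g: "g \<in> hom C k c" and h: "h \<in> hom C k c" and k: "k \<in> Ob C"
    and e: "cmp C f g = cmp C f h" for g h k
  proof -
    have actE: "act X x r = act X y (cmp C f r)" "act X x r \<in> El X k" if "r \<in> hom C k c" for r
      using X f xy that unfolding is_presheaf_def hom_def by auto
    let ?E = "elements C X" and ?p = "(act X x g, k)"
    have "act X x g = act X x h" using actE(1)[OF g] actE(1)[OF h] e by simp
    then have "(?p, g, (x, c)) \<in> hom ?E ?p (x, c)" "(?p, h, (x, c)) \<in> hom ?E ?p (x, c)"
      using g h xy actE(2)[OF g] by (simp_all add: hom_def[of ?E] Ar_elements_iff)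
    moreover have "?p \<in> Ob ?E" using k actE(2)[OF g] by simp
    ultimately have "(?p, g, (x, c)) = (?p, h, (x, c))"
      using m e unfolding monic_def by (metis elements_simps(1,4))
    then show ?thesis by simp
  qed
  then show ?thesis using f unfolding monic_def by auto
qed

text \<open>The inverse \<open>g\<close> of \<open>f\<close> restricts \<open>x\<close> back to
  \<open>y\<close>, so it lifts to the category of elements; the subcategory is full and thus
  contains the lift.\<close>

lemma iso_minimal_subcat_elements_if_iso:
  assumes C: "category C" and X: "is_presheaf C X"
    and a: "((x, c), f, (y, d)) \<in> Ar (minimal_subcat (elements C X))" and i: "iso C f"
  shows "iso (minimal_subcat (elements C X)) ((x, c), f, (y, d))"
proof -
  have f: "f \<in> Ar C" "Dom C f = c" "Cod C f = d" and xy: "x \<in> El X c" "y \<in> El X d" "act X y f = x"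
    using a by (auto simp: minimal_subcat_def full_subcat_def Ar_elements_iff hom_def)
  obtain g where g: "g \<in> hom C d c" "cmp C g f = idt C c" "cmp C f g = idt C d"
    using i f unfolding iso_def by auto
  have "act X x g = act X y (cmp C f g)"
    using f xy g(1) X unfolding is_presheaf_def hom_def by auto
  also have "\<dots> = y" using f xy g(3) X C unfolding is_presheaf_def category_def by auto
  finally have "((y, d), g, (x, c)) \<in> Ar (elements C X)" using g xy by (simp add: Ar_elements_iff)
  then show ?thesis
    using a g unfolding iso_def hom_def minimal_subcat_def full_subcat_def
    by (auto intro!: bexI[of _ "((y, d), g, (x, c))"])
qed

lemma dim_le_factorsE:
  assumes C: "category C" and X: "is_presheaf C X" and d: "dim_le C X n"
    and x: "c \<in> Ob C" "x \<in> El X c"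
  obtains m g z where "height_le C m n" "((x, c), g, (z, m)) \<in> Ar (elements C X)"
proof -
  \<comment> \<open>An inverse of the inclusion is itself the identity on elements, so every element
    of \<open>X\<close> lies in the skeleton.\<close>
  obtain \<theta> where "presheaf_map C X (skeleton C n X) \<theta>" "\<forall>c\<in>Ob C. \<forall>x\<in>El X c. \<theta> c x = x"
    using d unfolding dim_le_def presheaf_iso_def by blast
  then have "x \<in> El (skeleton C n X) c" using x unfolding presheaf_map_def by fastforce
  then obtain e y m g h where *: "y \<in> El X e" "m \<in> Ob (height_subcat C n)"
      "g \<in> hom C c m" "h \<in> hom C m e" "x = act X y (cmp C h g)"
    unfolding skeleton_def by auto
  have "act X (act X y h) g = x" "act X y h \<in> El X m"
    using * X unfolding is_presheaf_def hom_def by auto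
  then show thesis
    using that[of m g "act X y h"] * x
    by (auto simp: Ar_elements_iff height_subcat_def full_subcat_def)
qed

theorem proposition7p6:
  fixes C :: "('o, 'a) cat" and X :: "('o, 'a, 'x) presheaf" and n :: nat
  assumes "category C"
    and "has_strong_epi_mono_factorizations C"
    and "is_presheaf C X"
    and "dim_le C X n"
  shows "holds_in_presheaf_topos (minimal_subcat (elements C X)) (IBD n)"
proof (rule IBD_holds_if_chains_contain_iso)
  let ?E = "elements C X"
  let ?M = "minimal_subcat ?E"
  note C = assms(1) and X = assms(3)
  show "category ?M"
    unfolding minimal_subcat_def by (intro category_full_subcat category_elements C X)
  have min: "minimal_obj ?E (Dom ?E a)" "minimal_obj ?E (Cod ?E a)" "a \<in> Ar ?E" if "a \<in> Ar ?M" for a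
    using that by (auto simp: minimal_subcat_def full_subcat_def)
  \<comment> \<open>\<open>fst (snd a)\<close> is the underlying map in \<open>C\<close>. Only the
    domain has to be minimal, so this also applies to maps that leave \<open>?M\<close>.\<close>
  have monicU: "monic C (fst (snd a))" if "a \<in> Ar ?E" "minimal_obj ?E (Dom ?E a)" for a
    using that monic_if_monic_elements[OF C X, of "fst (fst a)" "snd (fst a)" "fst (snd a)"
        "fst (snd (snd a))" "snd (snd (snd a))"] unfolding minimal_obj_def by auto
  have DC: "Dom C (fst (snd a)) = snd (Dom ?E a)" "Cod C (fst (snd a)) = snd (Cod ?E a)"
    if "a \<in> Ar ?E" for a
    using that by (auto simp: elements_def hom_def)
  have isoU: "iso ?M a" if "a \<in> Ar ?M" "iso C (fst (snd a))" for a
    using iso_minimal_subcat_elements_if_iso[OF C X, of "fst (fst a)" "snd (fst a)" "fst (snd a)"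
        "fst (snd (snd a))" "snd (snd (snd a))"] that by simp
  fix fs assume len: "length fs = Suc n" and comp: "composable ?M fs"
  obtain as a where fs: "fs = as @ [a]" and las: "length as = n"
    using len by (cases fs rule: rev_cases) auto
  have as: "set as \<subseteq> Ar ?M" and a: "a \<in> Ar ?M" using comp unfolding composable_def fs by auto
  have chain: "Cod ?E (fs ! i) = Dom ?E (fs ! Suc i)" if "i < n" for i
    using comp that len unfolding composable_def successively_conv_nth
    by (simp add: minimal_subcat_def full_subcat_def)
  obtain x c where xc: "Cod ?E a = (x, c)" by fastforce
  then have "c \<in> Ob C" "x \<in> El X c" using min(2)[OF a] by (auto simp: minimal_obj_def)
  then obtain m g z where m: "height_le C m n" and g: "((x, c), g, (z, m)) \<in> Ar ?E"
    using dim_le_factorsE[OF C X assms(4)] by blast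
  \<comment> \<open>The domain \<open>(x, c)\<close> of this map is minimal, being the codomain of
    \<open>a\<close>; nothing is claimed about \<open>(z, m)\<close>.\<close>
  have gm: "monic C g" using monicU[OF g] min(2)[OF a] xc by simp
  have gd: "Dom C g = c" "Cod C g = m" using DC[OF g] by auto
  let ?U = "\<lambda>a. fst (snd a)"
  \<comment> \<open>Absorbing \<open>g\<close> into the last map instead of appending it keeps the
    length at \<open>n + 1\<close>, as \<open>height_le C m n\<close> requires, while the chain now
    ends at \<open>m\<close>.\<close>
  let ?b = "cmp C g (?U a)"
  let ?gs = "map ?U as @ [?b]"
  have aU: "monic C (?U a)" "Cod C (?U a) = c" using monicU DC min[OF a] xc by auto
  then have bm: "monic C ?b" using monic_cmp[OF C _ gm] gd by simp
  have b: "Dom C ?b = Dom C (?U a)" "Cod C ?b = m"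
    using C aU gm gd unfolding category_def monic_def by auto
  have asm: "monic C (?U a')" if "a' \<in> set as" for a'
    using that as monicU min by (meson subsetD)
  have "Cod C (?gs ! i) = Dom C (?gs ! Suc i)" if i: "i < n" for i
  proof -
    have "as ! i \<in> Ar ?E" "fs ! Suc i \<in> Ar ?E"
      using as a i las by (auto simp: fs nth_append intro!: min(3) subsetD[OF as])
    moreover have "Dom C (?gs ! Suc i) = Dom C (?U (fs ! Suc i))" "?gs ! i = ?U (as ! i)" "fs ! i = as ! i"
      using i las b by (auto simp: fs nth_append)
    ultimately show ?thesis using chain[OF i] DC by simp
  qed
  moreover have "\<forall>f\<in>set ?gs. monic C f" using asm bm by auto
  moreover have "length ?gs = n + 1" "Cod C (last ?gs) = m" using las b by auto
  ultimately obtain f where f: "f \<in> set ?gs" "iso C f" using m unfolding height_le_def by blast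
  show "\<exists>f\<in>set fs. iso ?M f"
  proof (cases "f = ?b")
    case True
    \<comment> \<open>Since \<open>g\<close> is monic, an isomorphism \<open>?b\<close> forces the
      last map of the original chain to be one.\<close>
    then have "iso C (?U a)"
      using iso_right_if_iso_cmp_monic[OF C _ gm] f aU gd unfolding monic_def by auto
    then show ?thesis using isoU[OF a] fs by simp
  next
    case False
    then obtain a' where "a' \<in> set as" "f = ?U a'" using f(1) by auto
    then show ?thesis using f(2) isoU[of a'] as fs by (intro bexI[of _ a']) auto
  qed
qed

end
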